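(* $\hat{R}^k_{\mathrm{ind}}(P_n)=O(k^3\log^4k)\,n$; that is, there is an absolute constant $C>0$ such that for every integer $k\ge 2$ and all sufficiently large $n$, $\hat{R}^k_{\mathrm{ind}}(P_n)\le C k^3\log^4 k\cdot n$.
   Context: $P_n$ denotes the path on $n$ vertices. For a graph $H$ and an integer $k\ge 1$, the $k$-colour induced size-Ramsey number $\hat{R}^k_{\mathrm{ind}}(H)$ is the smallest integer $m$ such that there exists a graph $G$ with $m$ edges with the property that for every colouring of the edges of $G$ with $k$ colours, there is a monochromatic copy of $H$ in $G$ which is an induced subgraph of $G$. *)

theory Defs
  imports Complex_Main "HOL-Library.FuncSet" "HOL-Library.Extended_Real"
begin

(* A graph is a pair (V, E) of a vertex set and a set of edges, an edge being a
   two-element set of vertices. *)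
type_synonym 'a graph = "'a set \<times> 'a set set"

definition verts :: "'a graph \<Rightarrow> 'a set" where
  "verts G = fst G"

definition edges :: "'a graph \<Rightarrow> 'a set set" where
  "edges G = snd G"

definition finite_simple_graph :: "'a graph \<Rightarrow> bool" where
  "finite_simple_graph G \<longleftrightarrow>
     finite (verts G) \<and> (\<forall>e\<in>edges G. e \<subseteq> verts G \<and> card e = 2)"

definition graph_iso :: "'a graph \<Rightarrow> 'b graph \<Rightarrow> bool" where
  "graph_iso G H \<longleftrightarrow>
     (\<exists>f. bij_betw f (verts G) (verts H) \<and>
       (\<forall>u\<in>verts G. \<forall>v\<in>verts G. {u, v} \<in> edges G \<longleftrightarrow> {f u, f v} \<in> edges H))"

definition induced_subgraph :: "'a graph \<Rightarrow> 'a graph \<Rightarrow> bool" where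
  "induced_subgraph F G \<longleftrightarrow>
     verts F \<subseteq> verts G \<and> edges F = {e \<in> edges G. e \<subseteq> verts F}"

definition monochromatic :: "('a set \<Rightarrow> nat) \<Rightarrow> 'a graph \<Rightarrow> bool" where
  "monochromatic c F \<longleftrightarrow> (\<exists>i. \<forall>e\<in>edges F. c e = i)"

definition induced_ramsey :: "nat \<Rightarrow> 'a graph \<Rightarrow> 'b graph \<Rightarrow> bool" where
  "induced_ramsey k H G \<longleftrightarrow>
     (\<forall>c \<in> edges G \<rightarrow> {..<k}.
        \<exists>F. induced_subgraph F G \<and> graph_iso H F \<and> monochromatic c F)"

(* Every finite graph is isomorphic to one whose vertices are natural numbers, so
   host graphs on naturals suffice.  The infimum in enat is the minimum whenever
   some host graph exists, and infinity otherwise. *)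
definition ind_size_ramsey :: "nat \<Rightarrow> 'a graph \<Rightarrow> enat" where
  "ind_size_ramsey k H =
     Inf {enat m | m. \<exists>G :: nat graph.
            finite_simple_graph G \<and> card (edges G) = m \<and> induced_ramsey k H G}"

definition path_graph :: "nat \<Rightarrow> nat graph" where
  "path_graph n = ({..<n}, {{i, Suc i} | i. Suc i < n})"

end

(*
  A host graph with a linear number of edges in which every set of 2n + Ln vertices, L of
  order log k, spans fewer than 2Ln edges exists by counting.  A densest colour class
  contains a core F of minimum degree at least 4L.  Run a depth-first search in F which
  extends the current path S only by a vertex with no neighbour in the host on S other than
  the tip; otherwise the tip dies.  When a vertex v dies, each F-neighbour of v still
  unvisited has a second neighbour on the path, so at every moment unvisited F-neighbours of
  dead vertices have at least two neighbours among visited vertices.  If n vertices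
  die before the path reaches n vertices, the many F-edges at dead vertices together with
  this property produce a set of vertices that spans too many edges.
*)
theory Submission
  imports Defs
begin

section \<open>Locally sparse graphs\<close>

text \<open>The single term n^n / n! of the exponential series is at most e^n, and e <= 3.\<close>

lemma power_self_le_fact: "real n ^ n \<le> 3 ^ n * fact n"
proof -
  have s: "summable (\<lambda>m. real n ^ m /\<^sub>R fact m)"
    by (rule summable_exp_generic)
  have "real n ^ n /\<^sub>R fact n = (\<Sum>m\<in>{n}. real n ^ m /\<^sub>R fact m)"
    by simp
  also have "\<dots> \<le> exp (real n)"
    unfolding exp_def by (rule sum_le_suminf[OF s]) auto
  also have "\<dots> = exp 1 ^ n"
    by (simp flip: exp_of_nat_mult)
  also have "\<dots> \<le> 3 ^ n"
    by (intro power_mono exp_le) auto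
  finally show ?thesis
    by (simp add: field_simps)
qed

text \<open>Combines n^j / j! with the factorial bound. Up to the factor 3^j this matches the lower
  bound (n/j)^j, so the union bound below loses only constants in the base.\<close>

lemma binomial_le_power_ratio: "real (n choose j) \<le> (3 * real n / real j) ^ j"
proof (cases "j = 0")
  case False
  have "real (n choose j) * real j ^ j \<le> real (n choose j) * (3 ^ j * fact j)"
    by (intro mult_left_mono power_self_le_fact) auto
  also have "\<dots> = 3 ^ j * real ((n choose j) * fact j)"
    by simp
  also have "\<dots> \<le> 3 ^ j * real (n ^ j)"
    using binomial_fact_pow[of n j] by (intro mult_left_mono) (simp_all only: of_nat_le_iff, simp)
  finally show ?thesis
    using False by (simp add: field_simps power_divide power_mult_distrib)
qed simp

section \<open>Counting graphs that contain a dense small vertex set\<close>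

definition pairs :: "'a set \<Rightarrow> 'a set set" where
  "pairs V = {e. e \<subseteq> V \<and> card e = 2}"

definition spanned :: "'a set set \<Rightarrow> 'a set \<Rightarrow> 'a set set" where
  "spanned E Y = {e \<in> E. e \<subseteq> Y}"

lemma finite_pairs: "finite V \<Longrightarrow> finite (pairs V)"
  unfolding pairs_def by simp

lemma card_pairs: "finite V \<Longrightarrow> card (pairs V) = card V choose 2"
  unfolding pairs_def by (rule n_subsets)

lemma card_supersets_le:
  assumes "finite P" "F \<subseteq> P"
  shows "card {E. F \<subseteq> E \<and> E \<subseteq> P \<and> card E = m} \<le> (card P - card F) choose (m - card F)"
proof -
  have fF: "finite F"
    using assms finite_subset by blast
  have "card {E. F \<subseteq> E \<and> E \<subseteq> P \<and> card E = m} \<le> card {A. A \<subseteq> P - F \<and> card A = m - card F}"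
  proof (rule card_inj_on_le)
    show "inj_on (\<lambda>E. E - F) {E. F \<subseteq> E \<and> E \<subseteq> P \<and> card E = m}"
      by (rule inj_onI) blast
    show "(\<lambda>E. E - F) ` {E. F \<subseteq> E \<and> E \<subseteq> P \<and> card E = m} \<subseteq> {A. A \<subseteq> P - F \<and> card A = m - card F}"
      using fF by (auto simp: card_Diff_subset)
  qed (use assms in simp)
  also have "\<dots> = (card P - card F) choose (m - card F)"
    using assms fF by (subst n_subsets) (auto simp: card_Diff_subset)
  finally show ?thesis .
qed

text \<open>A first-moment argument in counting form. A uniformly random m-edge graph contains a
  fixed set of j pairs with probability (m choose j) / ((card V choose 2) choose j), so
  \<open>small\<close> says that the expected number of j-sets of edges lying inside some y-set,
  counted once per y-set, is below 1.\<close>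

lemma locally_sparse_exists:
  fixes V :: "'a set"
  assumes fin: "finite V" and jm: "j \<le> m" and mP: "m \<le> card V choose 2"
    and small: "(card V choose y) * ((y choose 2) choose j) * (m choose j) < (card V choose 2) choose j"
  shows "\<exists>E \<subseteq> pairs V. card E = m \<and> (\<forall>Y \<subseteq> V. card Y = y \<longrightarrow> card (spanned E Y) < j)"
proof (rule ccontr)
  assume "\<not> ?thesis"
  then have bad: "\<exists>Y \<subseteq> V. card Y = y \<and> j \<le> card (spanned E Y)" if "E \<subseteq> pairs V" "card E = m" for E
    using that by (auto simp flip: not_less)
  define P where "P = pairs V"
  \<comment> \<open>If no graph works, each candidate E is charged to a witness (Y, F): a dense Y
    and j edges F of E inside it. \<open>B F\<close> collects the candidates that contain F.\<close>
  define I where "I = (SIGMA Y:{Y. Y \<subseteq> V \<and> card Y = y}. {F. F \<subseteq> pairs Y \<and> card F = j})"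
  define B where "B F = {E. F \<subseteq> E \<and> E \<subseteq> P \<and> card E = m}" for F :: "'a set set"
  have fP: "finite P" and cP: "card P = card V choose 2"
    using fin by (auto simp: P_def finite_pairs card_pairs)
  have fY: "finite Y" if "Y \<subseteq> V" for Y
    using that fin finite_subset by blast
  have "card I = (\<Sum>Y\<in>{Y. Y \<subseteq> V \<and> card Y = y}. card {F. F \<subseteq> pairs Y \<and> card F = j})"
    unfolding I_def using fin fY by (intro card_SigmaI) (auto simp: finite_pairs)
  also have "\<dots> = (\<Sum>Y\<in>{Y. Y \<subseteq> V \<and> card Y = y}. (y choose 2) choose j)"
    using fY by (intro sum.cong refl) (auto simp: n_subsets finite_pairs card_pairs)
  finally have cI: "card I = (card V choose y) * ((y choose 2) choose j)"
    using fin by (simp add: n_subsets)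
  have fI: "finite I"
    unfolding I_def using fin fY by (intro finite_SigmaI) (auto simp: finite_pairs)
  have cB: "card (B F) \<le> ((card V choose 2) - j) choose (m - j)" if "(Y, F) \<in> I" for Y F
  proof -
    have "F \<subseteq> P" "card F = j"
      using that by (auto simp: I_def P_def pairs_def)
    then show ?thesis
      using card_supersets_le[OF fP, of F m] by (simp add: B_def cP)
  qed
  have cover: "{E. E \<subseteq> P \<and> card E = m} \<subseteq> (\<Union>p\<in>I. B (snd p))"
  proof
    fix E assume "E \<in> {E. E \<subseteq> P \<and> card E = m}"
    then have E: "E \<subseteq> P" "card E = m" by auto
    then obtain Y where Y: "Y \<subseteq> V" "card Y = y" "j \<le> card (spanned E Y)"
      using bad by (auto simp: P_def)
    then obtain F where "F \<subseteq> spanned E Y" "card F = j"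
      by (meson obtain_subset_with_card_n)
    then have "(Y, F) \<in> I" "E \<in> B F"
      using Y E by (auto simp: I_def B_def spanned_def P_def pairs_def)
    then show "E \<in> (\<Union>p\<in>I. B (snd p))" by force
  qed
  have "(card V choose 2) choose m = card {E. E \<subseteq> P \<and> card E = m}"
    using fP cP by (simp add: n_subsets)
  also have "\<dots> \<le> card (\<Union>p\<in>I. B (snd p))"
    using fP fI by (intro card_mono cover) (auto simp: B_def)
  also have "\<dots> \<le> (\<Sum>p\<in>I. card (B (snd p)))"
    by (rule card_UN_le[OF fI])
  also have "\<dots> \<le> (\<Sum>p\<in>I. ((card V choose 2) - j) choose (m - j))"
    using cB by (intro sum_mono) auto
  also have "\<dots> = (card V choose y) * ((y choose 2) choose j) * (((card V choose 2) - j) choose (m - j))"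
    by (simp add: cI)
  finally have le: "(card V choose 2) choose m \<le> \<dots>" .
  have pos: "((card V choose 2) - j) choose (m - j) > 0"
    using jm mP by (intro zero_less_binomial) auto
  \<comment> \<open>Marking j elements of an m-set counts the same as choosing the j-set first and
    then extending it. This trades the number of supersets for \<open>m choose j\<close>, so that
    \<open>le\<close> contradicts \<open>small\<close>.\<close>
  have "((card V choose 2) choose j) * (((card V choose 2) - j) choose (m - j))
      = ((card V choose 2) choose m) * (m choose j)"
    using choose_mult[OF jm mP] by simp
  also have "\<dots> \<le> (card V choose y) * ((y choose 2) choose j) * (((card V choose 2) - j) choose (m - j)) * (m choose j)"
    by (rule mult_right_mono[OF le]) simp
  also have "\<dots> = (card V choose y) * ((y choose 2) choose j) * (m choose j) * (((card V choose 2) - j) choose (m - j))"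
    by simp
  also have "\<dots> < ((card V choose 2) choose j) * (((card V choose 2) - j) choose (m - j))"
    using small pos by (rule mult_strict_right_mono)
  finally show False by simp
qed

section \<open>Parameters that satisfy the counting condition\<close>

text \<open>Bounding the binomials by (3n/j)^j from above and (n/j)^j from below leaves (3z)^y
  r^(2b) < 1 to show, with r = 18 \<Delta> / z. Since y = b + 2n and \<open>zL\<close> gives z^(2n)
  <= 3^b, the left side is at most (27 z r^2)^b: an L of logarithmic size makes the extra 2n
  vertices cost only a constant factor in the base.\<close>

lemma binomial_union_bound:
  fixes n L \<Delta> z :: nat
  assumes n: "n \<ge> 1" and L: "L \<ge> 2" and \<Delta>: "\<Delta> \<ge> 1"
    and z: "z = 10000 * \<Delta>\<^sup>2" and zL: "z\<^sup>2 \<le> 3 ^ L"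
  defines "b \<equiv> L * n" and "y \<equiv> (L + 2) * n"
  defines "N \<equiv> z * y"
  shows "(N choose y) * ((y choose 2) choose (2 * b)) * (\<Delta> * N choose (2 * b)) < (N choose 2) choose (2 * b)"
    and "2 * b \<le> \<Delta> * N" and "\<Delta> * N \<le> N choose 2"
proof -
  have y: "y = b + 2 * n"
    by (simp add: y_def b_def algebra_simps)
  have "2 * n \<le> b"
    unfolding b_def by (rule mult_le_mono1[OF L])
  then have y: "y = b + 2 * n" "y \<le> 2 * b"
    using y by auto
  have b: "b \<ge> 1" and y1: "y \<ge> 1"
    using n L y by (auto simp: b_def)
  have z1: "z \<ge> 10000"
    using \<Delta> by (simp add: z)
  have \<Delta>z: "4 * \<Delta> \<le> z"
    using \<Delta> by (simp add: z power2_eq_square)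
  have N: "N \<ge> z"
    using y1 by (simp add: N_def)
  have "2 * b \<le> y * 2"
    using y by simp
  also have "\<dots> \<le> y * z"
    using z1 by simp
  also have "\<dots> \<le> \<Delta> * N"
    using \<Delta> by (simp add: N_def)
  finally show bN: "2 * b \<le> \<Delta> * N" .
  have N2: "real (N choose 2) = real N * (real N - 1) / 2"
  proof -
    have "2 * (N choose 2) = N * (N - 1)"
      unfolding choose_two by (cases "even N") auto
    then have "2 * real (N choose 2) = real N * real (N - 1)"
      by (metis of_nat_mult of_nat_numeral)
    then show ?thesis
      using N z1 by (simp add: of_nat_diff)
  qed
  have P: "(real N)\<^sup>2 / 4 \<le> real (N choose 2)"
    using N z1 by (simp add: N2 field_simps power2_eq_square)
  have "4 * \<Delta> * N \<le> N * N"
    using \<Delta>z N by (intro mult_right_mono) auto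
  then have "real (4 * \<Delta> * N) \<le> real (N * N)"
    by (simp only: of_nat_le_iff)
  then have "real (\<Delta> * N) \<le> real (N choose 2)"
    using P by (simp add: power2_eq_square)
  then show \<Delta>N: "\<Delta> * N \<le> N choose 2"
    by linarith
  have Q: "real (y choose 2) \<le> (real y)\<^sup>2 / 2"
  proof -
    have "2 * (y choose 2) \<le> y * (y - 1)"
      by (simp add: choose_two)
    also have "\<dots> \<le> y\<^sup>2"
      by (simp add: power2_eq_square)
    finally have "real (2 * (y choose 2)) \<le> real (y\<^sup>2)"
      by (simp only: of_nat_le_iff)
    then show ?thesis by simp
  qed
  \<comment> \<open>\<open>p\<close> is the base of the lower bound for the right-hand side, and
    \<open>r\<close> is what remains of the two edge factors after division by \<open>p\<close>. The
    18 collects the two factors 3, the halving in \<open>Q\<close>, the bound y <= 2b and the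
    quarter in \<open>P\<close>.\<close>
  define r where "r = 18 * real \<Delta> / real z"
  define p where "p = real (N choose 2) / real (2 * b)"
  have p0: "p > 0"
    using P N z1 b by (auto simp: p_def N2)
  have ratio: "(3 * real (y choose 2) / real (2 * b)) * (3 * real (\<Delta> * N) / real (2 * b)) \<le> r * p"
  proof -
    have pos: "real N > 0" "real b > 0" "real y > 0" "real z > 0"
      using N z1 b y1 by auto
    have "(3 * real (y choose 2) / real (2 * b)) * (3 * real (\<Delta> * N) / real (2 * b))
      \<le> (3 * ((real y)\<^sup>2 / 2) / real (2 * b)) * (3 * real (\<Delta> * N) / real (2 * b))"
      using Q by (intro mult_right_mono divide_right_mono mult_left_mono) auto
    also have "\<dots> = (9 * real \<Delta> * real N / (4 * real b)) * real y * (real y / (2 * real b))"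
      by (simp add: power2_eq_square)
    also have "\<dots> \<le> (9 * real \<Delta> * real N / (4 * real b)) * real y * 1"
      using y b by (intro mult_left_mono) (auto simp: divide_le_eq)
    also have "\<dots> = r * ((real N)\<^sup>2 / 4 / real (2 * b))"
      using pos by (simp add: r_def N_def field_simps power2_eq_square)
    also have "\<dots> \<le> r * p"
      unfolding p_def by (intro mult_left_mono divide_right_mono P) (auto simp: r_def)
    finally show ?thesis .
  qed
  have main: "(3 * real z) ^ y * r ^ (2 * b) < 1"
  proof -
    have "(3::real) ^ y \<le> 3 ^ (2 * b)"
      using y by (intro power_increasing) auto
    then have a: "(3::real) ^ y \<le> 9 ^ b"
      by (simp add: power_mult)
    have "real (z\<^sup>2) \<le> real (3 ^ L)"
      using zL by (simp only: of_nat_le_iff)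
    then have zL': "real (z\<^sup>2) ^ n \<le> real (3 ^ L) ^ n"
      by (rule power_mono) simp
    have "real z ^ (2 * n) = real (z\<^sup>2) ^ n"
      by (simp add: power_mult)
    also note zL'
    also have "real (3 ^ L) ^ n = 3 ^ b"
      by (simp add: b_def power_mult)
    finally have c: "real z ^ y \<le> real z ^ b * 3 ^ b"
      using z1 by (simp add: y power_add)
    have "(3 * real z) ^ y * r ^ (2 * b) = 3 ^ y * real z ^ y * (r\<^sup>2) ^ b"
      by (simp add: power_mult power_mult_distrib)
    also have "\<dots> \<le> 9 ^ b * (real z ^ b * 3 ^ b) * (r\<^sup>2) ^ b"
      using a c by (intro mult_right_mono mult_mono) auto
    also have "\<dots> = (9 * (real z * 3) * r\<^sup>2) ^ b"
      by (simp only: power_mult_distrib)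
    \<comment> \<open>The base is 27 * 18^2 * \<Delta>^2 / z, so the constant 10000 in z only has to
      exceed 8748.\<close>
    also have "9 * (real z * 3) * r\<^sup>2 = 8748 / 10000"
      using \<Delta> by (simp add: r_def z power2_eq_square field_simps)
    also have "(8748 / 10000 :: real) ^ b < 1"
      using b power_strict_decreasing[of 0 b "8748 / 10000 :: real"] by simp
    finally show ?thesis .
  qed
  have Ny: "3 * real N / real y = 3 * real z"
    using y1 by (simp add: N_def)
  have "real ((N choose y) * ((y choose 2) choose (2 * b)) * (\<Delta> * N choose (2 * b)))
     \<le> (3 * real N / real y) ^ y * (3 * real (y choose 2) / real (2 * b)) ^ (2 * b) *
        (3 * real (\<Delta> * N) / real (2 * b)) ^ (2 * b)"
    unfolding of_nat_mult[of "_ * _"] of_nat_mult[of "N choose y"]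
    by (intro mult_mono binomial_le_power_ratio) auto
  also have "\<dots> = (3 * real z) ^ y * ((3 * real (y choose 2) / real (2 * b)) * (3 * real (\<Delta> * N) / real (2 * b))) ^ (2 * b)"
    unfolding Ny power_mult_distrib[of "3 * real (y choose 2) / real (2 * b)"] by (simp only: mult.assoc)
  also have "\<dots> \<le> (3 * real z) ^ y * (r * p) ^ (2 * b)"
    by (intro mult_left_mono power_mono ratio) auto
  also have "\<dots> = (3 * real z) ^ y * r ^ (2 * b) * p ^ (2 * b)"
    by (simp add: power_mult_distrib)
  also have "\<dots> < 1 * p ^ (2 * b)"
    using main p0 by (intro mult_strict_right_mono) auto
  also have "\<dots> \<le> real ((N choose 2) choose (2 * b))"
    unfolding p_def using binomial_ge_n_over_k_pow_k[of "2 * b" "N choose 2", where ?'a = real] bN \<Delta>N by simp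
  finally show "(N choose y) * ((y choose 2) choose (2 * b)) * (\<Delta> * N choose (2 * b)) < (N choose 2) choose (2 * b)"
    by (simp only: of_nat_less_iff)
qed

section \<open>Dense cores and depth-first search for induced paths\<close>

lemma spanned_mono: "Y \<subseteq> Z \<Longrightarrow> spanned E Y \<subseteq> spanned E Z"
  unfolding spanned_def by blast

text \<open>Take W maximising the number of spanned edges minus D * card W. Deleting a vertex of
  degree below D would increase this value, and comparison with W = V bounds the edges lost. The
  potential can be negative, hence the integers.\<close>

lemma dense_core:
  fixes E :: "'a set set"
  assumes fin: "finite V" "finite E"
  shows "\<exists>W \<subseteq> V. card (spanned E V) \<le> card (spanned E W) + D * card V
     \<and> (\<forall>v\<in>W. D \<le> card {e \<in> spanned E W. v \<in> e})"
proof -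
  define f where "f W = int (card (spanned E W)) - int D * int (card W)" for W :: "'a set"
  have "finite (f ` Pow V)" "f ` Pow V \<noteq> {}"
    using fin by auto
  then have "Max (f ` Pow V) \<in> f ` Pow V"
    by (rule Max_in)
  then obtain W where W: "W \<subseteq> V" "f W = Max (f ` Pow V)"
    by auto
  have max: "f U \<le> f W" if "U \<subseteq> V" for U
    using that \<open>finite (f ` Pow V)\<close> by (simp add: W)
  have "D \<le> card {e \<in> spanned E W. v \<in> e}" if v: "v \<in> W" for v
  proof -
    have "card (spanned E W) = card (spanned E (W - {v}) \<union> {e \<in> spanned E W. v \<in> e})"
      by (rule arg_cong[of _ _ card]) (auto simp: spanned_def)
    also have "\<dots> = card (spanned E (W - {v})) + card {e \<in> spanned E W. v \<in> e}"
      using fin(2) by (intro card_Un_disjoint) (auto simp: spanned_def)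
    finally have "card (spanned E W) = \<dots>" .
    moreover have "card W = Suc (card (W - {v}))"
      using v W fin by (metis card.remove finite_subset)
    ultimately show ?thesis
      using max[of "W - {v}"] W(1) by (auto simp: f_def algebra_simps)
  qed
  moreover have "card (spanned E V) \<le> card (spanned E W) + D * card V"
  proof -
    have "0 \<le> int D * int (card W)"
      by simp
    then have "int (card (spanned E V)) - int D * int (card V) \<le> int (card (spanned E W))"
      using max[OF order.refl] unfolding f_def by linarith
    then show ?thesis
      by (simp flip: of_nat_mult of_nat_add add: diff_le_eq)
  qed
  ultimately show ?thesis using W by blast
qed

(* The tip of the path is the head of the list. *)
definition induced_path :: "'a set set \<Rightarrow> 'a set set \<Rightarrow> 'a list \<Rightarrow> bool" where
  "induced_path E F S \<longleftrightarrow> distinct S \<and>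
     (\<forall>i j. i < j \<longrightarrow> j < length S \<longrightarrow>
        ({S ! i, S ! j} \<in> E \<longrightarrow> j = Suc i) \<and> (j = Suc i \<longrightarrow> {S ! i, S ! j} \<in> F))"

lemma induced_path_Nil: "induced_path E F []"
  by (simp add: induced_path_def)

lemma induced_path_singleton: "induced_path E F [u]"
  by (simp add: induced_path_def)

lemma induced_path_tl: "induced_path E F (v # R) \<Longrightarrow> induced_path E F R"
  unfolding induced_path_def
proof (elim conjE, intro conjI allI impI)
  fix i j assume *: "\<forall>i j. i < j \<longrightarrow> j < length (v # R) \<longrightarrow>
      ({(v # R) ! i, (v # R) ! j} \<in> E \<longrightarrow> j = Suc i) \<and> (j = Suc i \<longrightarrow> {(v # R) ! i, (v # R) ! j} \<in> F)"
    and ij: "i < j" "j < length R"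
  show "j = Suc i" if "{R ! i, R ! j} \<in> E"
    using *[rule_format, of "Suc i" "Suc j"] ij that by simp
  show "{R ! i, R ! j} \<in> F" if "j = Suc i"
    using *[rule_format, of "Suc i" "Suc j"] ij that by simp
qed simp

lemma induced_path_Cons:
  assumes "induced_path E F (v # R)" "w \<notin> set (v # R)" "{w, v} \<in> F" "\<forall>u\<in>set R. {w, u} \<notin> E"
  shows "induced_path E F (w # v # R)"
  unfolding induced_path_def
proof (intro conjI allI impI)
  show "distinct (w # v # R)"
    using assms by (simp add: induced_path_def)
next
  fix i j assume ij: "i < j" "j < length (w # v # R)"
  have path: "\<forall>i j. i < j \<longrightarrow> j < length (v # R) \<longrightarrow>
      ({(v # R) ! i, (v # R) ! j} \<in> E \<longrightarrow> j = Suc i) \<and> (j = Suc i \<longrightarrow> {(v # R) ! i, (v # R) ! j} \<in> F)"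
    using assms(1) unfolding induced_path_def by blast
  from ij obtain j' where j: "j = Suc j'"
    by (cases j) auto
  show "j = Suc i" if "{(w # v # R) ! i, (w # v # R) ! j} \<in> E"
  proof (cases i)
    case 0
    show ?thesis
    proof (cases j')
      case (Suc m)
      then have "R ! m \<in> set R" using ij j by simp
      then show ?thesis using that assms(4) 0 j Suc by auto
    qed (use 0 j in simp)
  next
    case (Suc i')
    then show ?thesis using that ij j path[rule_format, of i' j'] by simp
  qed
  show "{(w # v # R) ! i, (w # v # R) ! j} \<in> F" if "j = Suc i"
  proof (cases i)
    case 0
    then show ?thesis using that assms by simp
  next
    case (Suc i')
    then have "{(v # R) ! i', (v # R) ! Suc i'} \<in> F"
      using ij that by (intro path[rule_format, THEN conjunct2, rule_format]) auto
    then show ?thesis using that Suc by simp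
  qed
qed

section \<open>The depth-first search\<close>

text \<open>\<open>S\<close> is the current path, \<open>T\<close> the set of dead vertices, and
  \<open>W - set S - T\<close> is unvisited. The last clause starts from adjacency in F but yields
  neighbours in the host E: a blocked extension reveals an edge of E only, and sparseness is a
  statement about E.\<close>

definition dfs_state :: "'a set set \<Rightarrow> 'a set set \<Rightarrow> 'a set \<Rightarrow> 'a list \<Rightarrow> 'a set \<Rightarrow> bool" where
  "dfs_state E F W S T \<longleftrightarrow>
     induced_path E F S \<and> set S \<subseteq> W \<and> T \<subseteq> W \<and> set S \<inter> T = {} \<and>
     (\<forall>w \<in> W - set S - T. (\<exists>v\<in>T. {w, v} \<in> F) \<longrightarrow>
        (\<exists>u\<in>set S \<union> T. \<exists>u'\<in>set S \<union> T. u \<noteq> u' \<and> {w, u} \<in> E \<and> {w, u'} \<in> E))"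

text \<open>The three moves are to start anew at an unvisited vertex when the path is empty, to
  extend the path at its tip, and to let the tip die. No move shrinks the visited set, so two
  visited neighbours, once found, remain.\<close>

lemma dfs_step:
  assumes st: "dfs_state E F W S T" and FE: "F \<subseteq> E" and fin: "finite W"
    and T: "card T < card W"
  shows "\<exists>S' T'. dfs_state E F W S' T' \<and>
    (length S' = Suc (length S) \<and> T' = T \<or> Suc (length S') = length S \<and> card T' = Suc (card T))"
proof -
  have ip: "induced_path E F S" and sub: "set S \<subseteq> W" "T \<subseteq> W" "set S \<inter> T = {}"
    and inv: "\<And>w. w \<in> W - set S - T \<Longrightarrow> \<exists>v\<in>T. {w, v} \<in> F \<Longrightarrow>
        \<exists>u\<in>set S \<union> T. \<exists>u'\<in>set S \<union> T. u \<noteq> u' \<and> {w, u} \<in> E \<and> {w, u'} \<in> E"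
    using st by (simp_all add: dfs_state_def)
  have dist: "distinct S"
    using ip by (simp add: induced_path_def)
  have fT: "finite T"
    using sub fin finite_subset by blast
  show ?thesis
  proof (cases S)
    case Nil
    have "\<not> W \<subseteq> T"
      using T fT by (meson card_mono not_le)
    then obtain u where u: "u \<in> W" "u \<notin> T" by blast
    have "dfs_state E F W [u] T"
      unfolding dfs_state_def
    proof (intro conjI ballI impI)
      fix w assume "w \<in> W - set [u] - T" "\<exists>v\<in>T. {w, v} \<in> F"
      then have "\<exists>x\<in>T. \<exists>x'\<in>T. x \<noteq> x' \<and> {w, x} \<in> E \<and> {w, x'} \<in> E"
        using inv[of w] by (simp add: Nil)
      then show "\<exists>x\<in>set [u] \<union> T. \<exists>x'\<in>set [u] \<union> T. x \<noteq> x' \<and> {w, x} \<in> E \<and> {w, x'} \<in> E"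
        by blast
    qed (use sub u in \<open>auto simp: induced_path_singleton\<close>)
    then show ?thesis
      by (intro exI[of _ "[u]"] exI[of _ T]) (simp add: Nil)
  next
    case (Cons v R)
    show ?thesis
    proof (cases "\<exists>w \<in> W - set S - T. {w, v} \<in> F \<and> (\<forall>u\<in>set R. {w, u} \<notin> E)")
      case True
      then obtain w where w: "w \<in> W - set S - T" "{w, v} \<in> F" "\<forall>u\<in>set R. {w, u} \<notin> E" by blast
      have "dfs_state E F W (w # v # R) T"
        unfolding dfs_state_def
      proof (intro conjI ballI impI)
        show "induced_path E F (w # v # R)"
          using w ip Cons by (intro induced_path_Cons) auto
        fix x assume "x \<in> W - set (w # v # R) - T" "\<exists>v\<in>T. {x, v} \<in> F"
        then have "\<exists>u\<in>set S \<union> T. \<exists>u'\<in>set S \<union> T. u \<noteq> u' \<and> {x, u} \<in> E \<and> {x, u'} \<in> E"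
          using inv[of x] Cons by simp
        moreover have "set S \<union> T \<subseteq> set (w # v # R) \<union> T"
          using Cons by auto
        ultimately show "\<exists>u\<in>set (w # v # R) \<union> T. \<exists>u'\<in>set (w # v # R) \<union> T. u \<noteq> u' \<and> {x, u} \<in> E \<and> {x, u'} \<in> E"
          by (meson subsetD)
      qed (use sub w Cons in auto)
      then show ?thesis
        by (intro exI[of _ "w # v # R"] exI[of _ T]) (simp add: Cons)
    next
      case False
      have "dfs_state E F W R (insert v T)"
        unfolding dfs_state_def
      proof (intro conjI ballI impI)
        show "induced_path E F R"
          using ip unfolding Cons by (rule induced_path_tl)
        show "set R \<subseteq> W" "insert v T \<subseteq> W" "set R \<inter> insert v T = {}"
          using sub dist Cons by auto
        fix w assume w: "w \<in> W - set R - insert v T" "\<exists>x\<in>insert v T. {w, x} \<in> F"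
        \<comment> \<open>The dying tip moves from the path to the dead set, so the visited set is
          unchanged and only the F-neighbours of v need a new argument.\<close>
        have wS: "w \<in> W - set S - T" and eq: "set R \<union> insert v T = set S \<union> T"
          using w Cons by auto
        show "\<exists>u\<in>set R \<union> insert v T. \<exists>u'\<in>set R \<union> insert v T. u \<noteq> u' \<and> {w, u} \<in> E \<and> {w, u'} \<in> E"
        proof (cases "\<exists>x\<in>T. {w, x} \<in> F")
          case True
          then show ?thesis
            using inv[OF wS] unfolding eq by blast
        next
          case no: False
          then have "{w, v} \<in> F" using w by auto
          \<comment> \<open>Since w did not qualify as an extension, it has a host neighbour on the
            path behind v. Together with v this makes two.\<close>
          then obtain u where "u \<in> set R" "{w, u} \<in> E"
            using False wS by blast
          moreover have "v \<noteq> u" "{w, v} \<in> E"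
            using \<open>{w, v} \<in> F\<close> FE \<open>u \<in> set R\<close> dist Cons by auto
          ultimately show ?thesis by blast
        qed
      qed
      moreover have "v \<notin> T" using sub Cons by auto
      ultimately show ?thesis
        using fT by (intro exI[of _ R] exI[of _ "insert v T"]) (simp add: Cons)
    qed
  qed
qed

text \<open>The quantity \<open>2 * card T + length S\<close> is a clock: an extension adds 1, and a
  death adds 2 - 1 = 1.\<close>

lemma dfs_run:
  assumes FE: "F \<subseteq> E" and fin: "finite W" and t: "t \<le> card W"
  shows "\<exists>S T. dfs_state E F W S T \<and> length S \<le> n \<and> card T \<le> t \<and>
     (length S = n \<or> card T = t \<or> 2 * card T + length S = m)"
proof (induction m)
  case 0
  have "dfs_state E F W [] {}"
    by (simp add: dfs_state_def induced_path_Nil)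
  then show ?case by (intro exI[of _ "[]"] exI[of _ "{}"]) simp
next
  case (Suc m)
  then obtain S T where ST: "dfs_state E F W S T" "length S \<le> n" "card T \<le> t"
    "length S = n \<or> card T = t \<or> 2 * card T + length S = m" by blast
  show ?case
  proof (cases "length S = n \<or> card T = t")
    case True
    then show ?thesis using ST by blast
  next
    case False
    then have lt: "length S < n" "card T < t" using ST by auto
    then obtain S' T' where "dfs_state E F W S' T'"
      "length S' = Suc (length S) \<and> T' = T \<or> Suc (length S') = length S \<and> card T' = Suc (card T)"
      using dfs_step[OF ST(1) FE fin] t by force
    then show ?thesis
      using lt ST False by (intro exI[of _ S'] exI[of _ T']) auto
  qed
qed

section \<open>Edge counts that refute an unsuccessful search\<close>

lemma sum_degrees_le:
  assumes "finite F" "finite T" "\<forall>e\<in>F. card e = 2"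
  shows "(\<Sum>v\<in>T. card {e \<in> F. v \<in> e}) \<le> 2 * card {e \<in> F. e \<inter> T \<noteq> {}}"
proof -
  define F' where "F' = {e \<in> F. e \<inter> T \<noteq> {}}"
  have "(\<Sum>v\<in>T. card {e \<in> F. v \<in> e}) = (\<Sum>v\<in>T. card {e \<in> F'. v \<in> e})"
    by (intro sum.cong refl arg_cong[of _ _ card]) (auto simp: F'_def)
  also have "\<dots> = (\<Sum>e\<in>F'. card {v \<in> T. v \<in> e})"
    using assms by (intro sum_multicount_gen) (auto simp: F'_def)
  also have "\<dots> \<le> (\<Sum>e\<in>F'. 2)"
  proof (rule sum_mono)
    fix e assume "e \<in> F'"
    then have "card e = 2" using assms by (simp add: F'_def)
    then show "card {v \<in> T. v \<in> e} \<le> 2"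
      using card_mono[of e "{v \<in> T. v \<in> e}"] card_ge_0_finite[of e] by auto
  qed
  finally show ?thesis by (simp add: F'_def mult.commute)
qed

text \<open>The edges meeting A in exactly one vertex w form classes that are disjoint for different
  w. Both edges from w into X belong to the class of w because X avoids A.\<close>

lemma card_doubly_attached_ge:
  assumes fin: "finite E" and disj: "A \<inter> X = {}" "finite A"
    and two: "\<forall>w\<in>A. \<exists>u\<in>X. \<exists>u'\<in>X. u \<noteq> u' \<and> {w, u} \<in> E \<and> {w, u'} \<in> E"
  shows "2 * card A \<le> card (spanned E (X \<union> A))"
proof -
  define B where "B w = {e \<in> spanned E (X \<union> A). e \<inter> A = {w}}" for w
  have fB: "finite (spanned E (X \<union> A))" "\<And>w. finite (B w)"
    using fin by (auto simp: B_def spanned_def)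
  have "2 \<le> card (B w)" if w: "w \<in> A" for w
  proof -
    obtain u u' where u: "u \<in> X" "u' \<in> X" "u \<noteq> u'" "{w, u} \<in> E" "{w, u'} \<in> E"
      using two w by blast
    have "{{w, u}, {w, u'}} \<subseteq> B w"
      using u w disj by (auto simp: B_def spanned_def)
    moreover have "card {{w, u}, {w, u'}} = 2"
      using u by (auto simp: doubleton_eq_iff)
    ultimately show ?thesis
      using card_mono[OF fB(2)] by metis
  qed
  then have "2 * card A \<le> (\<Sum>w\<in>A. card (B w))"
    using sum_bounded_below[of A 2 "\<lambda>w. card (B w)"] by (simp add: mult.commute)
  also have "\<dots> = card (\<Union>w\<in>A. B w)"
    using disj fB by (intro card_UN_disjoint[symmetric]) (auto simp: B_def)
  also have "\<dots> \<le> card (spanned E (X \<union> A))"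
    using fB by (intro card_mono) (auto simp: B_def)
  finally show ?thesis .
qed

text \<open>If n vertices die first, let X be the visited set, of size at most 2n, and A the
  unvisited F-neighbours of dead vertices. If A has at most b vertices, the edges at dead vertices
  make X together with A too dense. Otherwise b vertices of A, each with two host edges into X,
  already do so with X.\<close>

lemma long_induced_path:
  assumes E: "E \<subseteq> pairs V" and finV: "finite V" and FE: "F \<subseteq> E" and FW: "F \<subseteq> pairs W" "W \<subseteq> V"
    and deg: "\<forall>v\<in>W. D \<le> card {e \<in> F. v \<in> e}"
    and F: "card F \<ge> 2 * b" and D: "4 * b \<le> n * D"
    and sparse: "\<forall>Y\<subseteq>V. card Y \<le> 2 * n + b \<longrightarrow> card (spanned E Y) < 2 * b"
  shows "\<exists>S. induced_path E F S \<and> length S = n \<and> set S \<subseteq> V"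
proof -
  have fin: "finite W" "finite E" "finite F"
    using finV E FE FW finite_pairs finite_subset by metis+
  have "n \<le> card W"
  proof (rule ccontr)
    assume "\<not> n \<le> card W"
    then have "card (spanned E W) < 2 * b"
      using sparse FW by auto
    moreover have "F \<subseteq> spanned E W"
      using FE FW by (auto simp: spanned_def pairs_def)
    ultimately show False
      using F card_mono[of "spanned E W" F] fin by (auto simp: spanned_def)
  qed
  \<comment> \<open>Clock value 3n is enough: with both sizes at most n,
    \<open>2 * card T + length S = 3 * n\<close> forces both to equal n.\<close>
  then obtain S T where ST: "dfs_state E F W S T" "length S \<le> n" "card T \<le> n"
    "length S = n \<or> card T = n \<or> 2 * card T + length S = 3 * n"
    using dfs_run[OF FE fin(1), of n n "3 * n"] by blast
  have ip: "induced_path E F S" and sub: "set S \<subseteq> W" "T \<subseteq> W"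
    and inv: "\<And>w. w \<in> W - set S - T \<Longrightarrow> \<exists>v\<in>T. {w, v} \<in> F \<Longrightarrow>
        \<exists>u\<in>set S \<union> T. \<exists>u'\<in>set S \<union> T. u \<noteq> u' \<and> {w, u} \<in> E \<and> {w, u'} \<in> E"
    using ST(1) by (simp_all add: dfs_state_def)
  have fT: "finite T"
    using sub fin finite_subset by blast
  show ?thesis
  proof (cases "length S = n")
    case True
    then show ?thesis using ip sub FW by blast
  next
    case False
    then have T: "card T = n" using ST by auto
    define X where "X = set S \<union> T"
    define A where "A = {w \<in> W - X. \<exists>v\<in>T. {w, v} \<in> F}"
    have X: "X \<subseteq> W" "finite X" "card X \<le> 2 * n"
      using sub fT card_Un_le[of "set S" T] card_length[of S] ST(2,3)
      by (auto simp: X_def)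
    have A: "A \<subseteq> W" "A \<inter> X = {}" "finite A"
      using fin by (auto simp: A_def)
    have two: "\<forall>w\<in>A. \<exists>u\<in>X. \<exists>u'\<in>X. u \<noteq> u' \<and> {w, u} \<in> E \<and> {w, u'} \<in> E"
    proof
      fix w assume "w \<in> A"
      then have "w \<in> W - set S - T" "\<exists>v\<in>T. {w, v} \<in> F"
        by (auto simp: A_def X_def)
      then show "\<exists>u\<in>X. \<exists>u'\<in>X. u \<noteq> u' \<and> {w, u} \<in> E \<and> {w, u'} \<in> E"
        unfolding X_def by (rule inv)
    qed
    \<comment> \<open>The n dead vertices have F-degree at least D, so at least n * D / 2 >= 2b
      edges of F touch them. The other endpoint of such an edge is visited or lies in A.\<close>
    have dense: "2 * b \<le> card (spanned E (X \<union> A))"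
    proof -
      have "4 * b \<le> (\<Sum>v\<in>T. card {e \<in> F. v \<in> e})"
        using D sum_bounded_below[of T D "\<lambda>v. card {e \<in> F. v \<in> e}"] deg sub(2) T by force
      also have "\<dots> \<le> 2 * card {e \<in> F. e \<inter> T \<noteq> {}}"
        using fin fT FW by (intro sum_degrees_le) (auto simp: pairs_def)
      also have "{e \<in> F. e \<inter> T \<noteq> {}} \<subseteq> spanned E (X \<union> A)"
      proof
        fix e assume "e \<in> {e \<in> F. e \<inter> T \<noteq> {}}"
        then obtain v where v: "v \<in> e" "v \<in> T" and e: "e \<in> F" by blast
        then have "card e = 2" "e \<subseteq> W" using FW by (auto simp: pairs_def)
        then obtain w where w: "e = {w, v}" using v by (auto simp: card_2_iff)
        then show "e \<in> spanned E (X \<union> A)"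
          using v e FE \<open>e \<subseteq> W\<close> by (auto simp: spanned_def A_def X_def)
      qed
      then have "2 * card {e \<in> F. e \<inter> T \<noteq> {}} \<le> 2 * card (spanned E (X \<union> A))"
        using fin by (intro mult_left_mono card_mono) (auto simp: spanned_def)
      finally show ?thesis by simp
    qed
    have "\<exists>Y\<subseteq>V. card Y \<le> 2 * n + b \<and> 2 * b \<le> card (spanned E Y)"
    proof (cases "card A \<le> b")
      case True
      then show ?thesis
        using dense X A FW card_Un_le[of X A] by (intro exI[of _ "X \<union> A"]) auto
    next
      case False
      then obtain A' where A': "A' \<subseteq> A" "card A' = b"
        by (metis nat_le_linear obtain_subset_with_card_n)
      have "2 * card A' \<le> card (spanned E (X \<union> A'))"
      proof (rule card_doubly_attached_ge)
        show "finite A'" using A' A finite_subset by blast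
      qed (use fin A A' two in blast)+
      then have "2 * b \<le> card (spanned E (X \<union> A'))"
        using A' by simp
      then show ?thesis
        using A' X A FW card_Un_le[of X A'] by (intro exI[of _ "X \<union> A'"]) auto
    qed
    then show ?thesis using sparse by (meson not_le)
  qed
qed

section \<open>The host graph\<close>

lemma path_graph_edge_iff:
  "{i, j} \<in> edges (path_graph n) \<longleftrightarrow> i < n \<and> j < n \<and> (j = Suc i \<or> i = Suc j)"
  by (auto simp: edges_def path_graph_def doubleton_eq_iff)

text \<open>Host edges between entries of S join consecutive entries only, and those edges lie in F.
  Hence the whole induced subgraph on S inherits the colour of F.\<close>

lemma induced_path_iso:
  assumes S: "induced_path E F S" and F: "F \<subseteq> E" and E: "\<forall>e\<in>E. card e = 2"
  shows "graph_iso (path_graph (length S)) (set S, spanned E (set S))"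
    and "spanned E (set S) \<subseteq> F"
proof -
  have dist: "distinct S"
    and path: "\<And>i j. i < j \<Longrightarrow> j < length S \<Longrightarrow> {S ! i, S ! j} \<in> E \<Longrightarrow> j = Suc i"
      "\<And>i. Suc i < length S \<Longrightarrow> {S ! i, S ! Suc i} \<in> F"
    using S by (auto simp: induced_path_def)
  have adj: "{S ! i, S ! j} \<in> E \<longleftrightarrow> j = Suc i \<or> i = Suc j" if "i < length S" "j < length S" for i j
  proof (cases i j rule: linorder_cases)
    case less
    then show ?thesis using path(1)[of i j] path(2)[of i] that F by auto
  next
    case equal
    then show ?thesis using E by auto
  next
    case greater
    then show ?thesis using path(1)[of j i] path(2)[of j] that F by (auto simp: insert_commute)
  qed
  show "graph_iso (path_graph (length S)) (set S, spanned E (set S))"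
    unfolding graph_iso_def
  proof (intro exI[of _ "(!) S"] conjI ballI)
    show "bij_betw ((!) S) (verts (path_graph (length S))) (verts (set S, spanned E (set S)))"
      using dist by (simp add: verts_def path_graph_def bij_betw_nth)
    fix i j assume "i \<in> verts (path_graph (length S))" "j \<in> verts (path_graph (length S))"
    then have "i < length S" "j < length S"
      by (auto simp: verts_def path_graph_def)
    then show "{i, j} \<in> edges (path_graph (length S)) \<longleftrightarrow> {S ! i, S ! j} \<in> edges (set S, spanned E (set S))"
      using adj[of i j] by (simp add: path_graph_edge_iff edges_def[of "(_, _)"] spanned_def)
  qed
  show "spanned E (set S) \<subseteq> F"
  proof
    fix e assume e: "e \<in> spanned E (set S)"
    then obtain a b where ab: "e = {a, b}"
      using E by (metis (no_types, lifting) card_2_iff mem_Collect_eq spanned_def)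
    then have "a \<in> set S" "b \<in> set S"
      using e by (auto simp: spanned_def)
    then obtain i j where ij: "a = S ! i" "b = S ! j" "i < length S" "j < length S"
      by (auto simp: in_set_conv_nth)
    then have "j = Suc i \<or> i = Suc j"
      using adj[of i j] e ab by (simp add: spanned_def)
    then show "e \<in> F"
      using path(2)[of i] path(2)[of j] ij ab by (auto simp: insert_commute)
  qed
qed

text \<open>With \<Delta> = 8kL some colour has at least 8LN edges. Passing to a core of minimum
  degree D = 4L costs at most 4LN of them, leaving at least 4LN >= 2b, and b = Ln gives 4b = n * D
  as the search requires.\<close>

lemma induced_ramsey_path_host:
  fixes k n L \<Delta> z :: nat
  assumes n: "n \<ge> 1" and L: "L \<ge> 2" and k: "k \<ge> 1"
    and \<Delta>: "\<Delta> = 8 * k * L" and z: "z = 10000 * \<Delta>\<^sup>2" and zL: "z\<^sup>2 \<le> 3 ^ L"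
  shows "\<exists>G :: nat graph. finite_simple_graph G \<and> card (edges G) = \<Delta> * (z * ((L + 2) * n)) \<and>
           induced_ramsey k (path_graph n) G"
proof -
  define b y N where "b = L * n" and "y = (L + 2) * n" and "N = z * y"
  define V where "V = {..<N}"
  have \<Delta>1: "\<Delta> \<ge> 1"
    using k L by (simp add: \<Delta>)
  note bounds = binomial_union_bound[OF n L \<Delta>1 z zL, folded b_def y_def, folded N_def]
  have V: "finite V" "card V = N"
    by (auto simp: V_def)
  obtain E where E: "E \<subseteq> pairs V" "card E = \<Delta> * N"
    and sparse: "\<forall>Y\<subseteq>V. card Y = y \<longrightarrow> card (spanned E Y) < 2 * b"
    using locally_sparse_exists[OF V(1), of "2 * b" "\<Delta> * N" y] bounds unfolding V(2) by blast
  have fE: "finite E"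
    using E V finite_pairs finite_subset by blast
  have "y \<le> N" "n \<le> y"
    using \<Delta>1 by (auto simp: N_def y_def z)
  then have yN: "y \<le> N" "n \<le> N"
    by auto
  \<comment> \<open>As y = 2n + b <= N, a smaller set can be padded to size y, which only adds
    spanned edges.\<close>
  have sparse': "\<forall>Y\<subseteq>V. card Y \<le> 2 * n + b \<longrightarrow> card (spanned E Y) < 2 * b"
  proof (intro allI impI)
    fix Y assume Y: "Y \<subseteq> V" "card Y \<le> 2 * n + b"
    then have "card Y \<le> y"
      by (simp add: y_def b_def algebra_simps)
    then obtain Z where Z: "Y \<subseteq> Z" "Z \<subseteq> V" "card Z = y"
      using exists_subset_between[of Y y V] Y V yN by auto
    have "card (spanned E Y) \<le> card (spanned E Z)"
      using fE by (intro card_mono spanned_mono Z) (auto simp: spanned_def)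
    also have "\<dots> < 2 * b"
      using sparse Z by blast
    finally show "card (spanned E Y) < 2 * b" .
  qed
  have "\<exists>H. induced_subgraph H (V, E) \<and> graph_iso (path_graph n) H \<and> monochromatic c H"
    if c: "c \<in> E \<rightarrow> {..<k}" for c
  proof -
    have "\<exists>i<k. 8 * L * N \<le> card {e \<in> E. c e = i}"
    proof (rule ccontr)
      assume "\<not> ?thesis"
      then have less: "card {e \<in> E. c e = i} < 8 * L * N" if "i < k" for i
        using that by (meson not_le)
      have "E = (\<Union>i<k. {e \<in> E. c e = i})"
        using c by auto
      then have "card E \<le> (\<Sum>i<k. card {e \<in> E. c e = i})"
        using card_UN_le[of "{..<k}" "\<lambda>i. {e \<in> E. c e = i}"] by simp
      also have "\<dots> < (\<Sum>i<k. 8 * L * N)"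
        using k less by (intro sum_strict_mono) (auto simp: lessThan_empty_iff)
      finally show False
        by (simp add: E \<Delta>)
    qed
    then obtain i where i: "8 * L * N \<le> card {e \<in> E. c e = i}" by blast
    define Ei where "Ei = {e \<in> E. c e = i}"
    have Ei: "Ei \<subseteq> E" "finite Ei"
      using fE by (auto simp: Ei_def)
    obtain W where W: "W \<subseteq> V" "card (spanned Ei V) \<le> card (spanned Ei W) + 4 * L * card V"
      and deg: "\<forall>v\<in>W. 4 * L \<le> card {e \<in> spanned Ei W. v \<in> e}"
      using dense_core[OF V(1) Ei(2), of "4 * L"] by blast
    define F where "F = spanned Ei W"
    have FE: "F \<subseteq> E" "F \<subseteq> pairs W"
      using Ei E by (auto simp: F_def spanned_def pairs_def)
    have "spanned Ei V = Ei"
      using Ei E by (auto simp: spanned_def pairs_def)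
    then have "4 * L * N \<le> card F"
      using W(2) i unfolding Ei_def[symmetric] F_def V(2) by simp
    moreover have "2 * b \<le> 4 * L * N"
    proof -
      have "L * n \<le> L * N"
        using yN by simp
      then show ?thesis unfolding b_def mult.assoc by linarith
    qed
    ultimately have "2 * b \<le> card F" by simp
    moreover have "4 * b \<le> n * (4 * L)"
      by (simp add: b_def)
    ultimately obtain S where S: "induced_path E F S" "length S = n" "set S \<subseteq> V"
      using long_induced_path[OF E(1) V(1) FE W(1) deg[folded F_def] _ _ sparse'] by blast
    have two: "\<forall>e\<in>E. card e = 2"
      using E by (auto simp: pairs_def)
    note iso = induced_path_iso[OF S(1) FE(1) two]
    have "induced_subgraph (set S, spanned E (set S)) (V, E)"
      using S by (simp add: induced_subgraph_def verts_def edges_def spanned_def)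
    moreover have "monochromatic c (set S, spanned E (set S))"
      unfolding monochromatic_def
      using iso(2) by (intro exI[of _ i]) (auto simp: edges_def F_def spanned_def Ei_def)
    ultimately show ?thesis
      using iso(1) S(2) by blast
  qed
  then have "induced_ramsey k (path_graph n) (V, E)"
    by (simp add: induced_ramsey_def edges_def[of "(_, _)"])
  moreover have "finite_simple_graph (V, E)"
    using E V by (auto simp: finite_simple_graph_def verts_def edges_def pairs_def)
  moreover have "card (edges (V, E)) = \<Delta> * (z * ((L + 2) * n))"
    by (simp add: edges_def E N_def y_def)
  ultimately show ?thesis by blast
qed

section \<open>The logarithmic parameter and the final bound\<close>

text \<open>The left side of the last inequality is polynomial in k and L, so a large multiple of ln
  k for L lets 3^L dominate it. The 202 absorbs the rounding in L = 200 ln k, since 1 <= 2 ln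
  k.\<close>

lemma exists_log_parameter:
  fixes k :: nat
  assumes k: "k \<ge> 2"
  shows "\<exists>L::nat. L \<ge> 2 \<and> real L \<le> 202 * ln (real k) \<and> (10000 * (8 * k * L)\<^sup>2)\<^sup>2 \<le> 3 ^ L"
proof -
  define l where "l = ln (real k)"
  define L where "L = nat \<lceil>200 * l\<rceil>"
  have "1 / 2 \<le> ln (2::real)"
    using ln_le_minus_one[of "1 / 2 :: real"] by (simp add: ln_div)
  also have "\<dots> \<le> l"
    using k by (simp add: l_def)
  finally have l: "1 / 2 \<le> l" .
  have L: "200 * l \<le> real L" "real L \<le> 200 * l + 1"
    using l by (auto simp: L_def)
  have L0: "real L > 0" "L \<ge> 2"
    using L l by linarith+
  (* The tangent to ln at 32, together with ln 32 \<le> 5. *)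
  have lnL: "ln (real L) \<le> real L / 32 + 4"
  proof -
    have "ln (real L / 32) \<le> real L / 32 - 1"
      using L0 by (intro ln_le_minus_one) auto
    moreover have "ln (32::real) = 5 * ln 2"
      using ln_realpow[of 2 5] by simp
    moreover have "ln (2::real) \<le> 1"
      using ln_le_minus_one[of "2::real"] by simp
    ultimately show ?thesis
      using L0 by (simp add: ln_div)
  qed
  have c: "ln (640000::real) \<le> 20"
  proof -
    have "ln (640000::real) \<le> ln (2 ^ 20)"
      by simp
    also have "\<dots> = 20 * ln (2::real)"
      by (subst ln_realpow) auto
    also have "\<dots> \<le> 20"
      using ln_le_minus_one[of "2::real"] by simp
    finally show ?thesis .
  qed
  have "(10000 * (8 * real k * real L)\<^sup>2)\<^sup>2 = (640000 * (real k * real L)\<^sup>2)\<^sup>2"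
    by (simp add: power2_eq_square)
  also have "ln \<dots> = 2 * ln (640000 * (real k * real L)\<^sup>2)"
    using k L0 by (subst ln_realpow) auto
  also have "ln (640000 * (real k * real L)\<^sup>2) = ln 640000 + 2 * (l + ln (real L))"
    using k L0 by (simp add: ln_mult ln_realpow l_def)
  also have "2 * (ln 640000 + 2 * (l + ln (real L))) = 2 * ln 640000 + 4 * l + 4 * ln (real L)"
    by simp
  \<comment> \<open>The terms are at most 40, L/50 and L/8 + 16, and their sum is at most L because
    L >= 100.\<close>
  also have "\<dots> \<le> real L"
    using lnL c L l by linarith
  finally have "ln ((10000 * (8 * real k * real L)\<^sup>2)\<^sup>2) \<le> real L" .
  then have "(10000 * (8 * real k * real L)\<^sup>2)\<^sup>2 \<le> exp (real L)"
    using k L0 by (subst (asm) exp_le_cancel_iff[symmetric]) (simp add: exp_ln)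
  also have "exp (real L) = exp 1 ^ L"
    by (simp flip: exp_of_nat_mult)
  also have "\<dots> \<le> 3 ^ L"
    by (intro power_mono exp_le) auto
  finally have "real ((10000 * (8 * k * L)\<^sup>2)\<^sup>2) \<le> real (3 ^ L)"
    by simp
  then have "(10000 * (8 * k * L)\<^sup>2)\<^sup>2 \<le> 3 ^ L"
    by (simp only: of_nat_le_iff)
  then show ?thesis
    using L L0 l by (intro exI[of _ L]) (simp add: l_def)
qed

text \<open>The host has 10000 \<Delta>^3 (L + 2) n edges. The cube of \<Delta> = 8kL gives k^3 and
  three logarithms, and the fourth comes from the set size (L + 2) n.\<close>

lemma ind_size_ramsey_path_le:
  fixes k n :: nat
  assumes k: "k \<ge> 2" and n: "n \<ge> 1"
  shows "ereal_of_enat (ind_size_ramsey k (path_graph n))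
           \<le> ereal (10240000 * 202 ^ 4 * real k ^ 3 * ln (real k) ^ 4 * real n)"
proof -
  obtain L where L: "L \<ge> 2" "real L \<le> 202 * ln (real k)" "(10000 * (8 * k * L)\<^sup>2)\<^sup>2 \<le> 3 ^ L"
    using exists_log_parameter[OF k] by blast
  define m where "m = 8 * k * L * (10000 * (8 * k * L)\<^sup>2 * ((L + 2) * n))"
  have "real m = 5120000 * real k ^ 3 * real L ^ 3 * real (L + 2) * real n"
    by (simp add: m_def power2_eq_square power3_eq_cube algebra_simps)
  also have "\<dots> \<le> 5120000 * real k ^ 3 * real L ^ 3 * (2 * real L) * real n"
    using L(1) by (intro mult_right_mono mult_left_mono) auto
  also have "\<dots> = 10240000 * real k ^ 3 * real n * real L ^ 4"
    by (simp add: power3_eq_cube power4_eq_xxxx)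
  also have "\<dots> \<le> 10240000 * real k ^ 3 * real n * (202 * ln (real k)) ^ 4"
    using L(2) by (intro mult_left_mono power_mono) auto
  also have "\<dots> = 10240000 * 202 ^ 4 * real k ^ 3 * ln (real k) ^ 4 * real n"
    by (simp add: power_mult_distrib)
  finally have m_le: "real m \<le> 10240000 * 202 ^ 4 * real k ^ 3 * ln (real k) ^ 4 * real n" .
  obtain G :: "nat graph" where G: "finite_simple_graph G" "card (edges G) = m" "induced_ramsey k (path_graph n) G"
    using induced_ramsey_path_host[OF n L(1) _ refl refl L(3)] k unfolding m_def by auto
  then have "ind_size_ramsey k (path_graph n) \<le> enat m"
    unfolding ind_size_ramsey_def by (intro Inf_lower) blast
  then have "ereal_of_enat (ind_size_ramsey k (path_graph n)) \<le> ereal_of_enat (enat m)"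
    by (simp only: ereal_of_enat_le_iff)
  also have "\<dots> = ereal (real m)"
    by simp
  also have "\<dots> \<le> ereal (10240000 * 202 ^ 4 * real k ^ 3 * ln (real k) ^ 4 * real n)"
    using m_le by (simp only: ereal_less_eq)
  finally show ?thesis .
qed

theorem theorem1p2:
  "\<exists>C::real. C > 0 \<and>
     (\<forall>k::nat. k \<ge> 2 \<longrightarrow>
       (\<forall>\<^sub>F n::nat in sequentially.
          ereal_of_enat (ind_size_ramsey k (path_graph n))
            \<le> ereal (C * real k ^ 3 * ln (real k) ^ 4 * real n)))"
  using ind_size_ramsey_path_le
  \<comment> \<open>The constant is 10000 * 8^3 * 2 * 202^4, where the 2 comes from L + 2 <= 2L. The
    bound holds from n = 1 on for every k.\<close>
  by (intro exI[of _ "10240000 * 202 ^ 4"] conjI allI impI eventually_sequentiallyI[of 1]) auto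

end
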